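(* There exist a ring $R$ and an element $A\in R$ that is regular (hence $\pi$-regular) but not D-regularly nil clean.
   Context: All rings are associative with identity (not necessarily commutative). An element $r$ of a ring $R$ is called regular if $r=rxr$ for some $x\in R$, and $\pi$-regular if $r^n\in r^nRr^n$ for some positive integer $n$. An element $a$ of a ring $R$ is called D-regularly nil clean if there exists an idempotent $e\in aRa$ such that $a(1-e)$ is nilpotent. *)

theory Defs
  imports "HOL-Algebra.Ring"
begin

definition regular_elem :: "('a, 'm) ring_scheme \<Rightarrow> 'a \<Rightarrow> bool" where
  "regular_elem R r \<longleftrightarrow>
     r \<in> carrier R \<and> (\<exists>x\<in>carrier R. r = r \<otimes>\<^bsub>R\<^esub> x \<otimes>\<^bsub>R\<^esub> r)"

definition pi_regular_elem :: "('a, 'm) ring_scheme \<Rightarrow> 'a \<Rightarrow> bool" where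
  "pi_regular_elem R r \<longleftrightarrow>
     r \<in> carrier R \<and>
     (\<exists>n::nat. n > 0 \<and>
        (\<exists>x\<in>carrier R. r [^]\<^bsub>R\<^esub> n = r [^]\<^bsub>R\<^esub> n \<otimes>\<^bsub>R\<^esub> x \<otimes>\<^bsub>R\<^esub> r [^]\<^bsub>R\<^esub> n))"

definition idempotent_elem :: "('a, 'm) ring_scheme \<Rightarrow> 'a \<Rightarrow> bool" where
  "idempotent_elem R e \<longleftrightarrow> e \<in> carrier R \<and> e \<otimes>\<^bsub>R\<^esub> e = e"

definition nilpotent_elem :: "('a, 'm) ring_scheme \<Rightarrow> 'a \<Rightarrow> bool" where
  "nilpotent_elem R r \<longleftrightarrow>
     r \<in> carrier R \<and> (\<exists>n::nat. n > 0 \<and> r [^]\<^bsub>R\<^esub> n = \<zero>\<^bsub>R\<^esub>)"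

definition D_regularly_nil_clean :: "('a, 'm) ring_scheme \<Rightarrow> 'a \<Rightarrow> bool" where
  "D_regularly_nil_clean R a \<longleftrightarrow>
     a \<in> carrier R \<and>
     (\<exists>e \<in> {a \<otimes>\<^bsub>R\<^esub> x \<otimes>\<^bsub>R\<^esub> a | x. x \<in> carrier R}.
        idempotent_elem R e \<and> nilpotent_elem R (a \<otimes>\<^bsub>R\<^esub> (\<one>\<^bsub>R\<^esub> \<ominus>\<^bsub>R\<^esub> e)))"

text \<open>
  HOL cannot quantify existentially over types, so an existence claim about rings has to name
  the type containing the carrier.  For elements that are regular but not D-regularly nil clean
  the type of natural numbers loses no generality: if \<open>a = a y a\<close> in some ring, then the
  subring generated by \<open>a\<close> and \<open>y\<close> is countable, \<open>a\<close> is still regular in it, and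
  \<open>a\<close> is D-regularly nil clean in the whole ring if it is so in the subring.  The subring
  can be relabelled to have its carrier in the natural numbers; the operations are arbitrary.
\<close>

end

theory Submission
  imports Defs "HOL-Algebra.Weak_Morphisms" "HOL-Library.Countable"
begin

text \<open>
  In the ring of integer matrices of size 2, the matrix \<open>A\<close> with rows \<open>(2, 1)\<close> and \<open>(0, 0)\<close> has
  the form \<open>u v\<^sup>T\<close> for unimodular vectors \<open>u\<close>, \<open>v\<close>, so it is regular.  Every \<open>A X A\<close> is an
  integer multiple \<open>c A\<close>, and \<open>A\<^sup>2 = 2 A\<close>, so \<open>c A\<close> is idempotent only if \<open>2 c\<^sup>2 = c\<close>, that is,
  only if \<open>c = 0\<close>.  Then \<open>A (1 - c A) = A\<close> is not nilpotent.
\<close>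

lemma regular_elem_imp_pi_regular_elem:
  assumes "monoid R" and "regular_elem R r"
  shows "pi_regular_elem R r"
proof -
  interpret monoid R by fact
  have "r [^]\<^bsub>R\<^esub> (1 :: nat) = r"
    using assms(2) by (simp add: regular_elem_def)
  then show ?thesis
    using assms(2) unfolding regular_elem_def pi_regular_elem_def by (metis zero_less_one)
qed

context ring_hom_ring
begin

lemma regular_elem_hom:
  assumes "regular_elem R a"
  shows "regular_elem S (h a)"
  using assms unfolding regular_elem_def by (metis R.m_closed hom_closed hom_mult)

lemma idempotent_elem_hom:
  assumes "idempotent_elem R e"
  shows "idempotent_elem S (h e)"
  using assms unfolding idempotent_elem_def by (metis hom_closed hom_mult)

lemma nilpotent_elem_hom:
  assumes "nilpotent_elem R a"
  shows "nilpotent_elem S (h a)"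
  using assms unfolding nilpotent_elem_def by (metis hom_closed hom_nat_pow hom_zero)

text \<open>The property is an existential statement about ring equations, so a unital homomorphism
  carries the witness \<open>x\<close> to the witness \<open>h x\<close>. Read contrapositively, it
  moves the failure for matrices to any ring mapping onto them suitably.\<close>

lemma D_regularly_nil_clean_hom:
  assumes "D_regularly_nil_clean R a"
  shows "D_regularly_nil_clean S (h a)"
proof -
  obtain x where a: "a \<in> carrier R" and x: "x \<in> carrier R"
    and e: "idempotent_elem R (a \<otimes> x \<otimes> a)"
    and nil: "nilpotent_elem R (a \<otimes> (\<one> \<ominus> a \<otimes> x \<otimes> a))"
    using assms unfolding D_regularly_nil_clean_def by auto
  have "idempotent_elem S (h a \<otimes>\<^bsub>S\<^esub> h x \<otimes>\<^bsub>S\<^esub> h a)"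
    using idempotent_elem_hom[OF e] a x by simp
  moreover have "nilpotent_elem S (h a \<otimes>\<^bsub>S\<^esub> (\<one>\<^bsub>S\<^esub> \<ominus>\<^bsub>S\<^esub> h a \<otimes>\<^bsub>S\<^esub> h x \<otimes>\<^bsub>S\<^esub> h a))"
    using nilpotent_elem_hom[OF nil] a x by (simp add: a_minus_def)
  ultimately show ?thesis
    unfolding D_regularly_nil_clean_def using a x hom_closed by blast
qed

end

text \<open>The tuple \<open>(a, b, c, d)\<close> stands for the matrix with rows \<open>(a, b)\<close> and \<open>(c, d)\<close>.\<close>

definition int_mat2 :: "(int \<times> int \<times> int \<times> int) ring" where
  "int_mat2 =
     \<lparr>carrier = UNIV,
      monoid.mult = (\<lambda>(a, b, c, d) (a', b', c', d').
        (a * a' + b * c', a * b' + b * d', c * a' + d * c', c * b' + d * d')),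
      one = (1, 0, 0, 1),
      zero = (0, 0, 0, 0),
      add = (\<lambda>(a, b, c, d) (a', b', c', d'). (a + a', b + b', c + c', d + d'))\<rparr>"

lemma int_mat2_simps [simp]:
  "carrier int_mat2 = UNIV"
  "(a, b, c, d) \<otimes>\<^bsub>int_mat2\<^esub> (a', b', c', d') =
     (a * a' + b * c', a * b' + b * d', c * a' + d * c', c * b' + d * d')"
  "\<one>\<^bsub>int_mat2\<^esub> = (1, 0, 0, 1)"
  "\<zero>\<^bsub>int_mat2\<^esub> = (0, 0, 0, 0)"
  "(a, b, c, d) \<oplus>\<^bsub>int_mat2\<^esub> (a', b', c', d') = (a + a', b + b', c + c', d + d')"
  by (simp_all add: int_mat2_def)

lemma ring_int_mat2: "ring int_mat2"
proof (rule ringI)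
  show "abelian_group int_mat2"
  proof (rule abelian_groupI)
    fix x :: "int \<times> int \<times> int \<times> int"
    obtain a b c d where "x = (a, b, c, d)" by (cases x) auto
    then have "(- a, - b, - c, - d) \<oplus>\<^bsub>int_mat2\<^esub> x = \<zero>\<^bsub>int_mat2\<^esub>" by simp
    then show "\<exists>y\<in>carrier int_mat2. y \<oplus>\<^bsub>int_mat2\<^esub> x = \<zero>\<^bsub>int_mat2\<^esub>" by auto
  qed auto
  show "monoid int_mat2"
    by (rule monoidI) (auto simp: algebra_simps)
qed (auto simp: algebra_simps)

lemma regular_elem_int_mat2: "regular_elem int_mat2 (2, 1, 0, 0)"
proof -
  \<comment> \<open>For \<open>X = (p, q, r, s)\<close> the product \<open>A X A\<close> is
    \<open>2 * p + r\<close> times \<open>A\<close>; \<open>p = 0\<close>, \<open>r = 1\<close>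
    makes this factor 1.\<close>
  have "(2, 1, 0, 0) = (2, 1, 0, 0) \<otimes>\<^bsub>int_mat2\<^esub> (0, 0, 1, 0) \<otimes>\<^bsub>int_mat2\<^esub> (2, 1, 0, 0)"
    by simp
  then show ?thesis
    unfolding regular_elem_def by (metis UNIV_I int_mat2_simps(1))
qed

text \<open>\<open>A A = 2 A\<close> makes each positive power a power of 2 times \<open>A\<close>,
  hence nonzero. Exponents start at 1 because the zeroth power is the identity matrix.\<close>

lemma int_mat2_pow_Suc:
  "(2, 1, 0, 0) [^]\<^bsub>int_mat2\<^esub> Suc n = (2 ^ Suc n, 2 ^ n, 0, 0)"
proof (induction n)
  case 0
  interpret ring int_mat2 by (rule ring_int_mat2)
  show ?case by simp
next
  case (Suc n)
  interpret ring int_mat2 by (rule ring_int_mat2)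
  show ?case by (subst nat_pow_Suc, subst Suc.IH) simp
qed

lemma not_D_regularly_nil_clean_int_mat2:
  "\<not> D_regularly_nil_clean int_mat2 (2, 1, 0, 0)"
proof
  interpret ring int_mat2 by (rule ring_int_mat2)
  let ?A = "(2, 1, 0, 0) :: int \<times> int \<times> int \<times> int"
  assume "D_regularly_nil_clean int_mat2 ?A"
  then obtain x where e: "idempotent_elem int_mat2 (?A \<otimes>\<^bsub>int_mat2\<^esub> x \<otimes>\<^bsub>int_mat2\<^esub> ?A)"
    and nil: "nilpotent_elem int_mat2
      (?A \<otimes>\<^bsub>int_mat2\<^esub> (\<one>\<^bsub>int_mat2\<^esub> \<ominus>\<^bsub>int_mat2\<^esub> ?A \<otimes>\<^bsub>int_mat2\<^esub> x \<otimes>\<^bsub>int_mat2\<^esub> ?A))"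
    unfolding D_regularly_nil_clean_def by auto
  obtain p q r s where x: "x = (p, q, r, s)" by (cases x) auto
  define k where "k = 2 * p + r"
  have eq: "?A \<otimes>\<^bsub>int_mat2\<^esub> x \<otimes>\<^bsub>int_mat2\<^esub> ?A = (2 * k, k, 0, 0)"
    by (simp add: x k_def)
  \<comment> \<open>Comparing entries in the idempotent equation gives this. The common left factor
    \<open>k\<close> suits \<open>mult_cancel_left\<close>, which leaves \<open>k = 0\<close> or the
    equation \<open>2 * k = 1\<close>, impossible by parity.\<close>
  have "k * (2 * k) = k * 1"
    using e unfolding eq by (simp add: idempotent_elem_def)
  moreover have "2 * k \<noteq> 1" by presburger
  ultimately have "k = 0" by (simp only: mult_cancel_left) simp
  then have "?A \<otimes>\<^bsub>int_mat2\<^esub> x \<otimes>\<^bsub>int_mat2\<^esub> ?A = \<zero>\<^bsub>int_mat2\<^esub>"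
    using eq by simp
  \<comment> \<open>Since \<open>e\<close> is zero, \<open>1 - e\<close> is one by abstract ring
    laws; the tuple rules stay off so that zero and one keep the form these laws match.\<close>
  then have "nilpotent_elem int_mat2 ?A"
    using nil by (simp only: minus_zero a_minus_def r_zero one_closed)
      (simp del: int_mat2_simps(2-5) add: int_mat2_simps(1))
  then obtain n where "n > 0" and "?A [^]\<^bsub>int_mat2\<^esub> (n :: nat) = (0, 0, 0, 0)"
    unfolding nilpotent_elem_def by auto
  moreover obtain m where "n = Suc m" using \<open>n > 0\<close> by (cases n) auto
  ultimately show False using int_mat2_pow_Suc[of m] by simp
qed

theorem mainTheorem10:
  shows "\<exists>(R :: nat ring) A.
    ring R \<and> A \<in> carrier R \<and>
    regular_elem R A \<and> pi_regular_elem R A \<and> \<not> D_regularly_nil_clean R A"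
proof -
  interpret M: ring int_mat2 by (rule ring_int_mat2)
  let ?h = "to_nat :: int \<times> int \<times> int \<times> int \<Rightarrow> nat"
  let ?R = "image_ring ?h int_mat2"
  let ?A = "(2, 1, 0, 0) :: int \<times> int \<times> int \<times> int"
  have iso: "?h \<in> ring_iso int_mat2 ?R"
    by (rule inj_imp_image_ring_iso) simp
  interpret R: ring ?R
    by (rule M.inj_imp_image_ring_is_ring) simp
  interpret h: ring_hom_ring int_mat2 ?R ?h
    using iso by unfold_locales (simp add: ring_iso_def)
  \<comment> \<open>\<open>h\<close> carries regularity to the copy in \<open>nat\<close>;
    \<open>g\<close> goes back, so nil cleanness in the copy would give it for the matrix
    itself.\<close>
  interpret g: ring_hom_ring ?R int_mat2 "Hilbert_Choice.inv ?h"
    using inj_imp_image_ring_inv_iso[OF inj_to_nat, of int_mat2]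
    by unfold_locales (simp add: ring_iso_def)
  have reg: "regular_elem ?R (?h ?A)"
    by (rule h.regular_elem_hom[OF regular_elem_int_mat2])
  have "\<not> D_regularly_nil_clean ?R (?h ?A)"
  proof
    assume "D_regularly_nil_clean ?R (?h ?A)"
    from g.D_regularly_nil_clean_hom[OF this]
    show False using not_D_regularly_nil_clean_int_mat2 by simp
  qed
  then show ?thesis
    using reg regular_elem_imp_pi_regular_elem[OF R.monoid_axioms reg] R.ring_axioms
    unfolding regular_elem_def by blast
qed

end
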